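(* Let $G=(V,E)$ be a finite chordal graph and $n\geq 1$ an integer. Then $C(I_n(G))\leq n-1$.
   Context: Graphs are finite, simple and undirected. A graph is chordal if it contains no induced cycle of length at least $4$. For a graph $G=(V,E)$ and an integer $n\geq 1$, $I_n(G)$ is the simplicial complex $\{U\subseteq V:\ \alpha(G[U])<n\}$, where $G[U]$ is the induced subgraph and $\alpha$ denotes the independence number (maximum size of a set of pairwise non-adjacent vertices). For a finite simplicial complex $X$, a face $\sigma$ contained in a unique maximal face $\tau$ is a free face; if $|\sigma|\leq d$, removing all faces $\eta$ with $\sigma\subseteq\eta\subseteq\tau$ is an elementary $d$-collapse. $X$ is $d$-collapsible if a sequence of elementary $d$-collapses reduces it to the void complex (the complex with no faces, not even $\emptyset$). The collapsibility number $C(X)$ is the minimum $d$ such that $X$ is $d$-collapsible. *)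

theory Defs
  imports "HOL-Library.Ramsey"
begin

section \<open>Graphs\<close>

text \<open>A graph is given by its vertex set \<open>V\<close> and its set \<open>E\<close> of edges, which are
  two-element subsets of \<open>V\<close>, as in \<^theory>\<open>HOL-Library.Ramsey\<close>.\<close>

definition simple_graph :: "'a set \<Rightarrow> 'a set set \<Rightarrow> bool" where
  "simple_graph V E \<longleftrightarrow> finite V \<and> E \<subseteq> [V]\<^bsup>2\<^esup>"

text \<open>The induced subgraph \<open>G[U]\<close> has vertex set \<open>U\<close> and the following edges.\<close>

definition induced_edges :: "'a set set \<Rightarrow> 'a set \<Rightarrow> 'a set set" where
  "induced_edges E U = {e \<in> E. e \<subseteq> U}"

definition independence_number :: "'a set \<Rightarrow> 'a set set \<Rightarrow> nat" where
  "independence_number V E = Max (card ` {S. S \<subseteq> V \<and> indep S E})"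

text \<open>The list \<open>xs\<close> enumerates the vertices of an induced cycle in cyclic order: the only
  edges of \<open>G[set xs]\<close> are those of the cycle. The length of the cycle is \<open>length xs\<close>.\<close>

definition induced_cycle :: "'a set \<Rightarrow> 'a set set \<Rightarrow> 'a list \<Rightarrow> bool" where
  "induced_cycle V E xs \<longleftrightarrow>
     3 \<le> length xs \<and> distinct xs \<and> set xs \<subseteq> V \<and>
     induced_edges E (set xs) = {{xs ! i, xs ! (Suc i mod length xs)} | i. i < length xs}"

definition chordal :: "'a set \<Rightarrow> 'a set set \<Rightarrow> bool" where
  "chordal V E \<longleftrightarrow> \<not> (\<exists>xs. induced_cycle V E xs \<and> 4 \<le> length xs)"

section \<open>Simplicial complexes and collapsibility\<close>

text \<open>A complex is the set of its faces. The void complex is \<open>{}\<close>, which differs from the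
  complex \<open>{{}}\<close> whose only face is the empty one.\<close>

definition finite_complex :: "'a set set \<Rightarrow> bool" where
  "finite_complex X \<longleftrightarrow>
     finite X \<and> (\<forall>\<sigma>\<in>X. finite \<sigma>) \<and> (\<forall>\<sigma>\<in>X. \<forall>\<eta>. \<eta> \<subseteq> \<sigma> \<longrightarrow> \<eta> \<in> X)"

definition maximal_face :: "'a set set \<Rightarrow> 'a set \<Rightarrow> bool" where
  "maximal_face X \<tau> \<longleftrightarrow> \<tau> \<in> X \<and> (\<forall>\<eta>\<in>X. \<tau> \<subseteq> \<eta> \<longrightarrow> \<eta> = \<tau>)"

definition free_face_in :: "'a set set \<Rightarrow> 'a set \<Rightarrow> 'a set \<Rightarrow> bool" where
  "free_face_in X \<sigma> \<tau> \<longleftrightarrow>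
     \<sigma> \<in> X \<and> maximal_face X \<tau> \<and> \<sigma> \<subseteq> \<tau> \<and>
     (\<forall>\<tau>'. maximal_face X \<tau>' \<and> \<sigma> \<subseteq> \<tau>' \<longrightarrow> \<tau>' = \<tau>)"

definition elementary_collapse :: "nat \<Rightarrow> 'a set set \<Rightarrow> 'a set set \<Rightarrow> bool" where
  "elementary_collapse d X Y \<longleftrightarrow>
     (\<exists>\<sigma> \<tau>. free_face_in X \<sigma> \<tau> \<and> card \<sigma> \<le> d \<and> Y = X - {\<eta>. \<sigma> \<subseteq> \<eta> \<and> \<eta> \<subseteq> \<tau>})"

definition d_collapsible :: "nat \<Rightarrow> 'a set set \<Rightarrow> bool" where
  "d_collapsible d X \<longleftrightarrow> (elementary_collapse d)\<^sup>*\<^sup>* X {}"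

definition collapsibility_number :: "'a set set \<Rightarrow> nat" where
  "collapsibility_number X = (LEAST d. d_collapsible d X)"

text \<open>The minimum defining the collapsibility number is attained for every finite complex.\<close>

lemma ex_d_collapsible:
  assumes "finite_complex X"
  shows "\<exists>d. d_collapsible d X"
proof -
  have "(elementary_collapse d)\<^sup>*\<^sup>* Y {}" if "finite Y" "\<forall>\<sigma>\<in>Y. card \<sigma> \<le> d" for d and Y :: "'a set set"
    using that
  proof (induction Y rule: finite_psubset_induct)
    case (psubset Y)
    show ?case
    proof (cases "Y = {}")
      case False
      then obtain \<tau> where \<tau>: "\<tau> \<in> Y" "\<forall>\<eta>\<in>Y. \<tau> \<subseteq> \<eta> \<longrightarrow> \<eta> = \<tau>"
        using finite_has_maximal[OF psubset.hyps] by blast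
      have "{\<eta>. \<tau> \<subseteq> \<eta> \<and> \<eta> \<subseteq> \<tau>} = {\<tau>}" by blast
      moreover have "free_face_in Y \<tau> \<tau>"
        using \<tau> unfolding free_face_in_def maximal_face_def by blast
      ultimately have "elementary_collapse d Y (Y - {\<tau>})"
        using \<tau> psubset.prems unfolding elementary_collapse_def by metis
      moreover have "(elementary_collapse d)\<^sup>*\<^sup>* (Y - {\<tau>}) {}"
        using \<tau> psubset by (metis DiffD1 Diff_subset psubsetI Diff_iff insertI1)
      ultimately show ?thesis by (rule converse_rtranclp_into_rtranclp)
    qed simp
  qed
  moreover have "finite X" using assms by (simp add: finite_complex_def)
  ultimately show ?thesis
    unfolding d_collapsible_def by (metis Max_ge finite_imageI imageI)
qed

section \<open>The complex \<open>I\<^sub>n(G)\<close>\<close>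

definition bounded_indep_complex :: "nat \<Rightarrow> 'a set \<Rightarrow> 'a set set \<Rightarrow> 'a set set" where
  "bounded_indep_complex n V E =
     {U. U \<subseteq> V \<and> independence_number U (induced_edges E U) < n}"

lemma finite_complex_bounded_indep_complex:
  assumes "simple_graph V E"
  shows "finite_complex (bounded_indep_complex n V E)"
proof -
  have fin: "finite V" using assms by (simp add: simple_graph_def)
  have mono: "independence_number W (induced_edges E W) \<le> independence_number U (induced_edges E U)"
    if "W \<subseteq> U" "U \<subseteq> V" for W U
    unfolding independence_number_def
  proof (rule Max_mono)
    show "card ` {S. S \<subseteq> W \<and> indep S (induced_edges E W)}
        \<subseteq> card ` {S. S \<subseteq> U \<and> indep S (induced_edges E U)}"
      using that by (fastforce simp: indep_def induced_edges_def)
    have "indep {} (induced_edges E W)" by simp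
    then show "card ` {S. S \<subseteq> W \<and> indep S (induced_edges E W)} \<noteq> {}" by blast
    have "finite U" using fin that finite_subset by blast
    then show "finite (card ` {S. S \<subseteq> U \<and> indep S (induced_edges E U)})" by simp
  qed
  show ?thesis
    unfolding finite_complex_def
  proof (intro conjI ballI allI impI)
    show "finite (bounded_indep_complex n V E)"
      using fin by (simp add: bounded_indep_complex_def)
    show "finite \<sigma>" if "\<sigma> \<in> bounded_indep_complex n V E" for \<sigma>
      using fin that finite_subset by (auto simp: bounded_indep_complex_def)
    show "\<eta> \<in> bounded_indep_complex n V E"
      if "\<sigma> \<in> bounded_indep_complex n V E" "\<eta> \<subseteq> \<sigma>" for \<sigma> \<eta>
      using that mono[of \<eta> \<sigma>] by (auto simp: bounded_indep_complex_def)
  qed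
qed

end

(*
  Induct on the graph, removing a simplicial vertex v (Dirac). As N[v] is a clique, a set U
  containing v satisfies alpha(G[U]) = 1 + alpha(G[U - N[v]]), so the link of v in I_(n+1)(G) is
  the join of the full simplex on N(v) with I_n(G - N[v]). An elementary d-collapse of the latter
  complex lifts to an elementary (d+1)-collapse of I_(n+1)(G), and these lifted collapses delete
  all faces containing v, leaving I_(n+1)(G - v).
*)
theory Submission
  imports Defs
begin

section \<open>Simplicial vertices of chordal graphs\<close>

text \<open>\<open>E\<close> stays fixed while the vertex set shrinks in the inductions, so
  neighbours are taken within \<open>V\<close>.\<close>

definition nbhd :: "'a set \<Rightarrow> 'a set set \<Rightarrow> 'a \<Rightarrow> 'a set" where
  "nbhd V E v = {x \<in> V. {v, x} \<in> E}"

definition simplicial :: "'a set \<Rightarrow> 'a set set \<Rightarrow> 'a \<Rightarrow> bool" where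
  "simplicial V E v \<longleftrightarrow> v \<in> V \<and> clique (nbhd V E v) E"

lemma chordal_subset: "chordal V E \<Longrightarrow> W \<subseteq> V \<Longrightarrow> chordal W E"
  unfolding chordal_def induced_cycle_def by blast

lemma no_loop:
  assumes "\<forall>e\<in>E. card e = 2" shows "{x, x} \<notin> E"
  using assms by fastforce

section \<open>Induced cycles from shortest paths\<close>

text \<open>In a walk of least length \<open>m\<close>, a repeated vertex or a forward chord would
  allow an initial and a final segment to be spliced into a shorter walk.\<close>

lemma shortest_path_induced:
  assumes "(x, y) \<in> R\<^sup>*"
  obtains f m where "f 0 = x" "f m = y" "\<And>i. i < m \<Longrightarrow> (f i, f (Suc i)) \<in> R"
    "\<And>i j. i < j \<Longrightarrow> j \<le> m \<Longrightarrow> f i \<noteq> f j"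
    "\<And>i j. i < j \<Longrightarrow> j \<le> m \<Longrightarrow> (f i, f j) \<in> R \<Longrightarrow> j = Suc i"
proof -
  obtain m where m: "(x, y) \<in> R ^^ m" and least: "\<And>k. (x, y) \<in> R ^^ k \<Longrightarrow> m \<le> k"
  proof -
    obtain k where "(x, y) \<in> R ^^ k" using rtrancl_imp_relpow[OF assms] by blast
    then show ?thesis
      using that[of "LEAST k. (x, y) \<in> R ^^ k"] LeastI[of "\<lambda>k. (x, y) \<in> R ^^ k"]
        Least_le[of "\<lambda>k. (x, y) \<in> R ^^ k"] by blast
  qed
  from m obtain f where f: "f 0 = x" "f m = y" "\<forall>i<m. (f i, f (Suc i)) \<in> R"
    by (auto simp: relpow_fun_conv)
  have seg: "(f i, f j) \<in> R ^^ (j - i)" if "i \<le> j" "j \<le> m" for i j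
    unfolding relpow_fun_conv using that f(3) by (intro exI[of _ "\<lambda>k. f (i + k)"]) auto
  have initial: "(x, f i) \<in> R ^^ i" if "i \<le> m" for i
    using seg[of 0 i] that f(1) by simp
  have final: "(f j, y) \<in> R ^^ (m - j)" if "j \<le> m" for j
    using seg[of j m] that f(2) by simp
  have "f i \<noteq> f j" if "i < j" "j \<le> m" for i j
  proof
    assume "f i = f j"
    then have "(x, y) \<in> R ^^ (i + (m - j))"
      unfolding relpow_add using initial[of i] final[OF that(2)] that
      by (intro relcompI[of x "f i"]) simp_all
    from least[OF this] that show False by linarith
  qed
  moreover have "j = Suc i" if "i < j" "j \<le> m" "(f i, f j) \<in> R" for i j
  proof -
    have "(x, f i) \<in> R ^^ i" using initial[of i] that by simp
    then have "(x, f j) \<in> R ^^ Suc i" using that(3) by (rule relpow_Suc_I)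
    \<comment> \<open>Minimality against the walk through the chord gives
      \<open>m \<le> Suc i + (m - j)\<close>, hence \<open>j \<le> Suc i\<close>.\<close>
    then have "(x, y) \<in> R ^^ (Suc i + (m - j))"
      unfolding relpow_add using final[OF that(2)] by (rule relcompI)
    from least[OF this] that show ?thesis by linarith
  qed
  ultimately show ?thesis using that f by blast
qed

text \<open>Joining \<open>u\<close> to exactly the two ends of an induced path closes it into a
  cycle without chords. In the list, \<open>u\<close> has index 0 and \<open>f i\<close> has index
  \<open>Suc i\<close>.\<close>

lemma induced_cycleI:
  fixes f :: "nat \<Rightarrow> 'a"
  assumes E: "\<forall>e\<in>E. card e = 2"
    and V: "u \<in> V" "\<And>i. i \<le> m \<Longrightarrow> f i \<in> V"
    and m: "1 \<le> m"
    and path: "\<And>i. i < m \<Longrightarrow> {f i, f (Suc i)} \<in> E"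
    and dist: "\<And>i j. i < j \<Longrightarrow> j \<le> m \<Longrightarrow> f i \<noteq> f j"
    and chordless: "\<And>i j. i < j \<Longrightarrow> j \<le> m \<Longrightarrow> {f i, f j} \<in> E \<Longrightarrow> j = Suc i"
    and u: "\<And>i. i \<le> m \<Longrightarrow> u \<noteq> f i" "\<And>i. i \<le> m \<Longrightarrow> {u, f i} \<in> E \<longleftrightarrow> i = 0 \<or> i = m"
  shows "induced_cycle V E (u # map f [0..<Suc m])" (is "induced_cycle V E ?xs")
proof -
  have len: "length ?xs = m + 2" by simp
  have set_xs: "set ?xs = insert u (f ` {..m})"
    unfolding list.set set_map set_upt by (simp add: lessThan_Suc_atMost atLeast0LessThan)
  have nth_Suc: "?xs ! Suc i = f i" if "i \<le> m" for i
    using that by (simp del: upt_Suc add: nth_append)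
  have "inj_on f {..m}"
    by (rule linorder_inj_onI) (use dist in auto)
  then have "distinct ?xs"
    using u(1) unfolding distinct.simps distinct_map set_map set_upt
    by (auto simp: lessThan_Suc_atMost atLeast0LessThan)
  moreover have "induced_edges E (set ?xs)
      = {{?xs ! i, ?xs ! (Suc i mod length ?xs)} | i. i < length ?xs}" (is "?L = ?R")
  proof
    have R0: "{u, f 0} \<in> ?R"
      using m nth_Suc[of 0] by (intro CollectI exI[of _ 0]) auto
    \<comment> \<open>The closing edge: the successor of the last index \<open>Suc m\<close> wraps
      around to 0.\<close>
    have Rm: "{u, f m} \<in> ?R"
      using nth_Suc[of m] by (intro CollectI exI[of _ "Suc m"]) (auto simp del: upt_Suc)
    have RSuc: "{f i, f (Suc i)} \<in> ?R" if "i < m" for i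
      using nth_Suc[of i] nth_Suc[of "Suc i"] that
      by (intro CollectI exI[of _ "Suc i"]) (auto simp del: upt_Suc)
    have pair: "{f i, f j} \<in> ?R" if "i < j" "j \<le> m" "{f i, f j} \<in> E" for i j
      using chordless[OF that] RSuc that by simp
    have upair: "{u, f i} \<in> ?R" if "i \<le> m" "{u, f i} \<in> E" for i
      using u(2)[of i] that R0 Rm by auto
    show "?L \<subseteq> ?R"
    proof
      fix e assume "e \<in> ?L"
      then have e: "e \<in> E" "e \<subseteq> insert u (f ` {..m})"
        using set_xs by (auto simp: induced_edges_def)
      then obtain a b where ab: "e = {a, b}" "a \<noteq> b"
        using E by (meson card_2_iff)
      show "e \<in> ?R"
      proof (cases "a = u \<or> b = u")
        case True
        then obtain i where "i \<le> m" "e = {u, f i}"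
          using ab e(2) by auto
        then show ?thesis using upair e(1) by blast
      next
        case False
        then obtain i j where ij: "i \<le> m" "j \<le> m" "a = f i" "b = f j"
          using ab e(2) by auto
        then consider "i < j" | "j < i" using ab(2) by force
        then show ?thesis
          using pair[of i j] pair[of j i] ij ab(1) e(1) by cases (auto simp: insert_commute)
      qed
    qed
    show "?R \<subseteq> ?L"
    proof
      fix e assume "e \<in> ?R"
      then obtain k where k: "e = {?xs ! k, ?xs ! (Suc k mod length ?xs)}" "k < m + 2"
        using len by auto
      then consider "k = 0" | "k = Suc m" | i where "k = Suc i" "i < m"
        by (metis Suc_lessI add_2_eq_Suc' less_Suc_eq_0_disj)
      then have "e \<in> E"
      proof cases
        case 1
        then have "e = {u, f 0}" using k(1) nth_Suc[of 0] by simp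
        then show ?thesis using u(2)[of 0] by simp
      next
        case 2
        then have "e = {u, f m}" using k(1) nth_Suc[of m] by (auto simp del: upt_Suc)
        then show ?thesis using u(2)[of m] by simp
      next
        case 3
        then have "e = {f i, f (Suc i)}"
          using k(1) nth_Suc[of i] nth_Suc[of "Suc i"] by (auto simp del: upt_Suc)
        then show ?thesis using path 3 by simp
      qed
      moreover have "?xs ! k \<in> set ?xs" "?xs ! (Suc k mod length ?xs) \<in> set ?xs"
        by (rule nth_mem, use k(2) len in simp)+
      then have "e \<subseteq> set ?xs" unfolding k(1) by blast
      ultimately show "e \<in> ?L" by (simp add: induced_edges_def)
    qed
  qed
  moreover have "set ?xs \<subseteq> V"
    using V set_xs by auto
  ultimately show ?thesis
    unfolding induced_cycle_def using m by simp
qed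

text \<open>Nonadjacent \<open>x\<close> and \<open>y\<close> would be joined by a shortest path through \<open>C\<close>, which together
  with \<open>u\<close> is an induced cycle.\<close>

lemma component_boundary_clique:
  assumes E: "\<forall>e\<in>E. card e = 2" and chordal: "chordal V E"
    and u: "u \<in> V" and C: "C \<subseteq> V - insert u (nbhd V E u)"
    and conn: "\<And>a b. a \<in> C \<Longrightarrow> b \<in> C \<Longrightarrow> (a, b) \<in> {(a, b). a \<in> C \<and> b \<in> C \<and> {a, b} \<in> E}\<^sup>*"
    and S: "S \<subseteq> nbhd V E u" "\<And>s. s \<in> S \<Longrightarrow> \<exists>c\<in>C. {s, c} \<in> E"
  shows "clique S E"
  unfolding clique_def
proof (intro ballI impI, rule ccontr)
  fix x y assume xy: "x \<in> S" "y \<in> S" "x \<noteq> y" "{x, y} \<notin> E"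
  \<comment> \<open>A path inside \<open>D\<close> has its inner vertices in \<open>C\<close>, where
    \<open>u\<close> has no neighbours.\<close>
  define D where "D = insert x (insert y C)"
  define R where "R = {(a, b). a \<in> D \<and> b \<in> D \<and> {a, b} \<in> E}"
  obtain c d where cd: "c \<in> C" "{x, c} \<in> E" "d \<in> C" "{y, d} \<in> E"
    using S(2) xy by meson
  have "(c, d) \<in> R\<^sup>*"
    using conn[OF cd(1,3)] by (rule rtrancl_mono[THEN subsetD, rotated]) (auto simp: R_def D_def)
  moreover have "(x, c) \<in> R" "(d, y) \<in> R"
    using cd by (auto simp: R_def D_def insert_commute)
  ultimately have "(x, y) \<in> R\<^sup>*" by (meson rtrancl.simps converse_rtrancl_into_rtrancl)
  then obtain f m where f: "f 0 = x" "f m = y" "\<And>i. i < m \<Longrightarrow> (f i, f (Suc i)) \<in> R"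
    "\<And>i j. i < j \<Longrightarrow> j \<le> m \<Longrightarrow> f i \<noteq> f j"
    "\<And>i j. i < j \<Longrightarrow> j \<le> m \<Longrightarrow> (f i, f j) \<in> R \<Longrightarrow> j = Suc i"
    by (rule shortest_path_induced) blast
  \<comment> \<open>Since \<open>x\<close> and \<open>y\<close> are distinct and nonadjacent, the
    path has at least two edges, so the cycle of length \<open>m + 2\<close> contradicts
    chordality.\<close>
  have "m \<noteq> 0" using f(1,2) xy(3) by metis
  moreover have "m \<noteq> 1"
    using f(1,2) f(3)[of 0] xy by (auto simp: R_def)
  ultimately have m: "2 \<le> m" by linarith
  have fD: "f i \<in> D" if "i \<le> m" for i
    using f(1,2) f(3)[of i] that by (cases "i = m") (auto simp: R_def D_def)
  have fC: "f i \<in> C" if "0 < i" "i < m" for i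
    using fD[of i] f(4)[of 0 i] f(4)[of i m] f(1,2) that by (auto simp: D_def)
  have nb: "x \<in> V" "y \<in> V" "{u, x} \<in> E" "{u, y} \<in> E"
    using xy S(1) by (auto simp: nbhd_def)
  have u_notin: "u \<notin> D"
    using nb no_loop[OF E] C by (auto simp: D_def)
  have "induced_cycle V E (u # map f [0..<Suc m])"
  proof (rule induced_cycleI[OF E u])
    show "f i \<in> V" if "i \<le> m" for i
      using fD[OF that] nb C by (auto simp: D_def)
    show "{u, f i} \<in> E \<longleftrightarrow> i = 0 \<or> i = m" if "i \<le> m" for i
      using that fC[of i] C nb f(1,2) by (cases "i = 0 \<or> i = m") (auto simp: nbhd_def)
    show "j = Suc i" if "i < j" "j \<le> m" "{f i, f j} \<in> E" for i j
      using f(5)[of i j] that fD by (auto simp: R_def)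
    show "u \<noteq> f i" if "i \<le> m" for i using fD[OF that] u_notin by auto
  qed (use m f in \<open>auto simp: R_def\<close>)
  moreover have "4 \<le> length (u # map f [0..<Suc m])" using m by simp
  ultimately show False using chordal unfolding chordal_def by blast
qed

section \<open>Dirac's theorem on simplicial vertices\<close>

lemma simplicial_supergraph:
  assumes "simplicial H E v" "H \<subseteq> V" "nbhd V E v \<subseteq> H"
  shows "simplicial V E v"
proof -
  have "nbhd V E v = nbhd H E v" using assms(2,3) by (auto simp: nbhd_def)
  then show ?thesis using assms(1,2) by (auto simp: simplicial_def)
qed

text \<open>Avoiding the closed neighbourhood of \<open>u\<close> strengthens Dirac's theorem so
  that the induction works. Let \<open>C\<close> be a component of the non-neighbours of
  \<open>u\<close>. Its boundary \<open>S\<close> is a clique, and a vertex of \<open>C\<close> that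
  is simplicial in \<open>C \<union> S\<close> is simplicial in the whole graph.\<close>

lemma chordal_simplicial_vertex_avoiding:
  assumes "finite V" "\<forall>e\<in>E. card e = 2" "chordal V E" "u \<in> V" "V - insert u (nbhd V E u) \<noteq> {}"
  shows "\<exists>v \<in> V - insert u (nbhd V E u). simplicial V E v"
  using assms
proof (induction V arbitrary: u rule: finite_psubset_induct)
  case (psubset V)
  note E = \<open>\<forall>e\<in>E. card e = 2\<close>
  define W where "W = V - insert u (nbhd V E u)"
  obtain c\<^sub>0 where c0: "c\<^sub>0 \<in> W" using psubset.prems by (auto simp: W_def)
  define RW where "RW = {(a, b). a \<in> W \<and> b \<in> W \<and> {a, b} \<in> E}"
  define C where "C = {c. (c\<^sub>0, c) \<in> RW\<^sup>*}"
  define RC where "RC = {(a, b). a \<in> C \<and> b \<in> C \<and> {a, b} \<in> E}"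
  define S where "S = {s \<in> V - C. \<exists>c\<in>C. {s, c} \<in> E}"
  define H where "H = C \<union> S"
  have C_W: "c \<in> W" if "c \<in> C" for c
    using that[unfolded C_def, simplified] c0 by (induction rule: rtrancl_induct) (auto simp: RW_def)
  have C_step: "b \<in> C" if "a \<in> C" "{a, b} \<in> E" "b \<in> W" for a b
    using that C_W[of a] unfolding C_def
    by (auto intro: rtrancl_into_rtrancl simp: RW_def)
  have c0C: "c\<^sub>0 \<in> C" by (simp add: C_def)
  \<comment> \<open>Every vertex on a path in \<open>W\<close> from \<open>c\<^sub>0\<close> is
    itself reachable, so the path stays inside \<open>C\<close>.\<close>
  have c0_RC: "(c\<^sub>0, c) \<in> RC\<^sup>*" if "c \<in> C" for c
    using that[unfolded C_def, simplified]
  proof (induction rule: rtrancl_induct)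
    case (step y z)
    then have "(y, z) \<in> RC"
      by (auto simp: RC_def RW_def C_def intro: rtrancl_into_rtrancl)
    with step show ?case by simp
  qed simp
  have "sym RC" by (auto simp: RC_def sym_def insert_commute)
  then have conn: "(a, b) \<in> RC\<^sup>*" if "a \<in> C" "b \<in> C" for a b
    using c0_RC[OF that(1)] c0_RC[OF that(2)] by (meson rtrancl_trans sym_rtrancl symD)
  have C_V: "C \<subseteq> V - insert u (nbhd V E u)" using C_W by (auto simp: W_def)
  have S_nb: "S \<subseteq> nbhd V E u"
  proof
    fix s assume "s \<in> S"
    then obtain c where c: "s \<in> V" "s \<notin> C" "c \<in> C" "{s, c} \<in> E" by (auto simp: S_def)
    \<comment> \<open>A vertex of \<open>W\<close> adjacent to \<open>C\<close> would belong to the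
      component.\<close>
    have "s \<notin> W" using C_step[of c s] c by (auto simp: insert_commute)
    moreover have "s \<noteq> u" using c C_V by (auto simp: nbhd_def)
    ultimately show "s \<in> nbhd V E u" using c by (auto simp: W_def)
  qed
  have S_clique: "clique S E"
    using component_boundary_clique[OF E psubset.prems(2,3) C_V conn[unfolded RC_def] S_nb]
    by (auto simp: S_def)
  have u_H: "u \<notin> H"
    using C_V S_nb no_loop[OF E] by (auto simp: H_def nbhd_def)
  \<comment> \<open>\<open>H\<close> omits \<open>u\<close>, so the induction hypothesis applies to
    it.\<close>
  have H_V: "H \<subset> V" using u_H C_V psubset.prems(3) by (auto simp: H_def S_def)
  have nb_H: "nbhd V E c \<subseteq> H" if "c \<in> C" for c
    using that by (auto simp: H_def S_def nbhd_def insert_commute)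
  have lift: "\<exists>v \<in> V - insert u (nbhd V E u). simplicial V E v"
    if "v \<in> C" "simplicial H E v" for v
    using that simplicial_supergraph[OF that(2)] H_V nb_H C_V by blast
  have IH: "\<exists>v \<in> K - insert w (nbhd K E w). simplicial K E v"
    if "K \<subset> V" "w \<in> K" "K - insert w (nbhd K E w) \<noteq> {}" for K w
    using psubset.IH[OF that(1) E chordal_subset[OF psubset.prems(2)] that(2,3)] that(1) by blast
  show ?case
  proof (cases "\<exists>s\<in>S. H - insert s (nbhd H E s) \<noteq> {}")
    case True
    then obtain s where "s \<in> S" "H - insert s (nbhd H E s) \<noteq> {}" by blast
    moreover from this have "s \<in> H" by (simp add: H_def)
    ultimately obtain v where s: "s \<in> S" "v \<in> H - insert s (nbhd H E s)" "simplicial H E v"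
      using IH[OF H_V] by blast
    \<comment> \<open>\<open>S\<close> is a clique through \<open>s\<close>, so a vertex other than
      \<open>s\<close> and not adjacent to it cannot lie in \<open>S\<close>.\<close>
    then have "v \<in> C"
      using S_clique by (auto simp: H_def nbhd_def clique_def)
    then show ?thesis using lift s by blast
  next
    case False
    \<comment> \<open>Here each vertex of \<open>S\<close> is adjacent to all the rest of
      \<open>H\<close>. Hence a simplicial vertex of \<open>C\<close> stays simplicial in
      \<open>H\<close>: its additional neighbours lie in \<open>S\<close>.\<close>
    have "\<exists>v\<in>C. simplicial C E v"
    proof (cases "\<exists>w\<in>C. C - insert w (nbhd C E w) \<noteq> {}")
      case True
      then show ?thesis using IH[of C] H_V by (auto simp: H_def)
    next
      case False
      then have "clique C E" by (auto simp: clique_def nbhd_def)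
      then show ?thesis using c0C by (auto simp: simplicial_def nbhd_def clique_def)
    qed
    then obtain v where v: "v \<in> C" "clique (nbhd C E v) E" by (auto simp: simplicial_def)
    have dominating: "{s, h} \<in> E" if "s \<in> S" "h \<in> H" "s \<noteq> h" for s h
      using False that by (auto simp: nbhd_def)
    have "clique (nbhd H E v) E"
      unfolding clique_def
    proof (intro ballI impI)
      fix a b assume ab: "a \<in> nbhd H E v" "b \<in> nbhd H E v" "a \<noteq> b"
      then have "a \<in> H" "b \<in> H" by (auto simp: nbhd_def)
      then show "{a, b} \<in> E"
        using dominating[of a b] dominating[of b a] ab v(2)
        by (auto simp: H_def nbhd_def clique_def insert_commute)
    qed
    then have "simplicial H E v" using v by (auto simp: simplicial_def H_def)
    then show ?thesis using lift v by blast
  qed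
qed

text \<open>If no vertex has a non-neighbour, the graph is complete and every vertex is
  simplicial.\<close>

lemma chordal_ex_simplicial_vertex:
  assumes "finite V" "\<forall>e\<in>E. card e = 2" "chordal V E" "V \<noteq> {}"
  obtains v where "simplicial V E v"
proof (cases "\<exists>u\<in>V. V - insert u (nbhd V E u) \<noteq> {}")
  case True
  then show ?thesis using chordal_simplicial_vertex_avoiding[OF assms(1-3)] that by blast
next
  case False
  then have "clique V E" by (auto simp: clique_def nbhd_def)
  then show ?thesis using assms(4) that by (auto simp: simplicial_def nbhd_def clique_def)
qed

section \<open>Collapsing the star of a vertex\<close>

text \<open>The sets joined to \<open>Y\<close> form the open star of \<open>v\<close>, its link
  being the join of the full simplex on \<open>N - {v}\<close> with \<open>L\<close>. A free face
  \<sigma> in \<tau> lifts to \<open>insert v \<sigma>\<close> in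
  \<open>\<tau> \<union> insert v N\<close>; the extra vertex accounts for
  \<open>Suc d\<close>.\<close>

lemma elementary_collapse_star:
  assumes coll: "elementary_collapse d L L'"
    and L: "\<And>A. A \<in> L \<Longrightarrow> A \<inter> insert v N = {}"
    and Y: "\<And>U. U \<in> Y \<Longrightarrow> v \<notin> U"
  shows "elementary_collapse (Suc d) (Y \<union> {U. v \<in> U \<and> U - insert v N \<in> L})
    (Y \<union> {U. v \<in> U \<and> U - insert v N \<in> L'})" (is "elementary_collapse _ ?X ?X'")
proof -
  obtain \<sigma> \<tau> where free: "free_face_in L \<sigma> \<tau>" and card: "card \<sigma> \<le> d"
    and L': "L' = L - {\<eta>. \<sigma> \<subseteq> \<eta> \<and> \<eta> \<subseteq> \<tau>}"
    using coll unfolding elementary_collapse_def by blast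
  have \<sigma>: "\<sigma> \<in> L" "\<sigma> \<subseteq> \<tau>" and \<tau>: "\<tau> \<in> L" "\<And>\<eta>. \<eta> \<in> L \<Longrightarrow> \<tau> \<subseteq> \<eta> \<Longrightarrow> \<eta> = \<tau>"
    and uniq: "\<And>\<tau>'. maximal_face L \<tau>' \<Longrightarrow> \<sigma> \<subseteq> \<tau>' \<Longrightarrow> \<tau>' = \<tau>"
    using free unfolding free_face_in_def maximal_face_def by auto
  note disj = L[OF \<sigma>(1)] L[OF \<tau>(1)]
  let ?\<tau> = "\<tau> \<union> insert v N"
  have in_X: "A \<union> insert v N \<in> ?X" if "A \<in> L" for A
  proof -
    have "A \<union> insert v N - insert v N = A" using L[OF that] by blast
    then show ?thesis using that by simp
  qed
  have "insert v \<sigma> - insert v N = \<sigma>" using disj by blast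
  then have \<sigma>X: "insert v \<sigma> \<in> ?X" using \<sigma>(1) by simp
  have max: "maximal_face ?X ?\<tau>"
    unfolding maximal_face_def
  proof (intro conjI ballI impI)
    show "?\<tau> \<in> ?X" by (rule in_X[OF \<tau>(1)])
    fix \<eta> assume \<eta>: "\<eta> \<in> ?X" "?\<tau> \<subseteq> \<eta>"
    then have "\<eta> - insert v N \<in> L" using Y by blast
    moreover have "\<tau> \<subseteq> \<eta> - insert v N" using \<eta>(2) disj by blast
    ultimately have "\<eta> - insert v N = \<tau>" by (rule \<tau>(2))
    then show "\<eta> = ?\<tau>" using \<eta>(2) by blast
  qed
  have unique: "\<tau>' = ?\<tau>" if "maximal_face ?X \<tau>'" "insert v \<sigma> \<subseteq> \<tau>'" for \<tau>'
  proof -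
    let ?\<rho> = "\<tau>' - insert v N"
    have \<rho>: "?\<rho> \<in> L" using that Y unfolding maximal_face_def by blast
    have mx: "\<And>\<eta>. \<eta> \<in> ?X \<Longrightarrow> \<tau>' \<subseteq> \<eta> \<Longrightarrow> \<eta> = \<tau>'"
      using that(1) unfolding maximal_face_def by blast
    \<comment> \<open>Adding all of \<open>N\<close> does not change the part outside
      \<open>insert v N\<close>, so a maximal face through \<open>v\<close> contains
      \<open>N\<close>.\<close>
    have full: "?\<rho> \<union> insert v N = \<tau>'"
      by (rule mx[OF in_X[OF \<rho>]]) blast
    have "maximal_face L ?\<rho>"
      unfolding maximal_face_def
    proof (intro conjI ballI impI)
      \<comment> \<open>With \<open>insert v N\<close> added, a face of \<open>L\<close> above
        \<open>?\<rho>\<close> becomes a face above \<open>\<tau>'\<close>, so maximality passes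
        down to \<open>L\<close>.\<close>
      fix \<eta> assume \<eta>: "\<eta> \<in> L" "?\<rho> \<subseteq> \<eta>"
      have "\<eta> \<union> insert v N = \<tau>'"
        by (rule mx[OF in_X[OF \<eta>(1)]]) (use \<eta>(2) in blast)
      then show "\<eta> = ?\<rho>" using L[OF \<eta>(1)] by blast
    qed (rule \<rho>)
    moreover have "\<sigma> \<subseteq> ?\<rho>" using that(2) disj by blast
    ultimately have "?\<rho> = \<tau>" by (rule uniq)
    then show ?thesis using full by simp
  qed
  have "free_face_in ?X (insert v \<sigma>) ?\<tau>"
    unfolding free_face_in_def using \<sigma>X max unique \<sigma>(2) by blast
  \<comment> \<open>The case split reflects that \<open>card\<close> is 0 on infinite sets.\<close>
  moreover have "card (insert v \<sigma>) \<le> Suc d"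
    using card by (cases "finite \<sigma>") (auto simp: card_insert_if)
  moreover have "?X' = ?X - {\<eta>. insert v \<sigma> \<subseteq> \<eta> \<and> \<eta> \<subseteq> ?\<tau>}"
  proof -
    \<comment> \<open>Once \<open>v\<close> is in \<open>U\<close>, both inclusions test only the
      part outside \<open>insert v N\<close>. Thus the removed interval lies exactly over the one
      removed from \<open>L\<close>.\<close>
    have "\<sigma> \<subseteq> U - insert v N \<and> U - insert v N \<subseteq> \<tau> \<longleftrightarrow> insert v \<sigma> \<subseteq> U \<and> U \<subseteq> ?\<tau>"
      if "v \<in> U" for U
      using that disj by blast
    then have "v \<in> U \<and> U - insert v N \<in> L' \<longleftrightarrow>
        (v \<in> U \<and> U - insert v N \<in> L) \<and> \<not> (insert v \<sigma> \<subseteq> U \<and> U \<subseteq> ?\<tau>)" for U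
      unfolding L' mem_Collect_eq Diff_iff by meson
    moreover have "\<not> insert v \<sigma> \<subseteq> U" if "U \<in> Y" for U using Y[OF that] by simp
    ultimately show ?thesis
      unfolding set_eq_iff Un_iff Diff_iff mem_Collect_eq by meson
  qed
  ultimately show ?thesis unfolding elementary_collapse_def by blast
qed

text \<open>The collapses of \<open>L\<close> are lifted one after another. When \<open>L\<close>
  has become void, and not merely \<open>{{}}\<close>, no face containing \<open>v\<close> is left,
  and the collapses of \<open>Y\<close> finish.\<close>

lemma d_collapsible_star:
  assumes "d_collapsible d L" "d_collapsible (Suc d) Y"
    and L: "\<And>A. A \<in> L \<Longrightarrow> A \<inter> insert v N = {}"
    and Y: "\<And>U. U \<in> Y \<Longrightarrow> v \<notin> U"
  shows "d_collapsible (Suc d) (Y \<union> {U. v \<in> U \<and> U - insert v N \<in> L})"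
  using assms(1)[unfolded d_collapsible_def] L
proof (induction rule: converse_rtranclp_induct)
  case base
  then show ?case using assms(2) by simp
next
  case (step L L')
  have "L' \<subseteq> L" using step(1) by (auto simp: elementary_collapse_def)
  then show ?case
    using step elementary_collapse_star[OF step(1) step(4) Y] unfolding d_collapsible_def
    by (meson converse_rtranclp_into_rtranclp subsetD)
qed

section \<open>The link of a simplicial vertex\<close>

text \<open>Subsets of \<open>U\<close> are independent for \<open>E\<close> iff they are so for the
  edges inside \<open>U\<close>, and the maximum ranges over a finite set of cardinalities
  containing 0.\<close>

lemma mem_bounded_indep_complex:
  assumes "finite V"
  shows "U \<in> bounded_indep_complex n V E \<longleftrightarrow> U \<subseteq> V \<and> (\<forall>S\<subseteq>U. indep S E \<longrightarrow> card S < n)"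
proof (cases "U \<subseteq> V")
  case True
  then have "finite U" using assms finite_subset by blast
  have eq: "{S. S \<subseteq> U \<and> indep S (induced_edges E U)} = {S. S \<subseteq> U \<and> indep S E}"
    by (fastforce simp: indep_def induced_edges_def)
  have "{} \<in> {S. S \<subseteq> U \<and> indep S E}" by simp
  then have "card ` {S. S \<subseteq> U \<and> indep S E} \<noteq> {}" by blast
  then show ?thesis
    using True \<open>finite U\<close> by (auto simp: bounded_indep_complex_def independence_number_def eq)
qed (simp add: bounded_indep_complex_def)

text \<open>An independent set outside the closed neighbourhood of \<open>v\<close> can be enlarged
  by \<open>v\<close>. Conversely, that neighbourhood is a clique, so an independent set loses at
  most one vertex when it is removed.\<close>

lemma bounded_indep_complex_simplicial:
  assumes fin: "finite V" and simp: "simplicial V E v" and U: "U \<subseteq> V" "v \<in> U"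
  shows "U \<in> bounded_indep_complex (Suc n) V E \<longleftrightarrow>
    U - insert v (nbhd V E v) \<in> bounded_indep_complex n (V - insert v (nbhd V E v)) E"
proof -
  let ?N = "insert v (nbhd V E v)"
  have "(\<forall>S\<subseteq>U. indep S E \<longrightarrow> card S < Suc n) \<longleftrightarrow> (\<forall>S\<subseteq>U - ?N. indep S E \<longrightarrow> card S < n)"
  proof (intro iffI allI impI)
    fix S assume L: "\<forall>S\<subseteq>U. indep S E \<longrightarrow> card S < Suc n" and S: "S \<subseteq> U - ?N" "indep S E"
    have "indep (insert v S) E"
      using S U by (auto simp: indep_def nbhd_def insert_commute)
    moreover have "insert v S \<subseteq> U" using S(1) U(2) by blast
    ultimately have "card (insert v S) < Suc n" using L by simp
    moreover have "S \<subseteq> V" using S(1) U(1) by blast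
    then have "finite S" using fin by (rule finite_subset)
    moreover have "v \<notin> S" using S(1) by blast
    ultimately show "card S < n" by simp
  next
    fix S assume R: "\<forall>S\<subseteq>U - ?N. indep S E \<longrightarrow> card S < n" and S: "S \<subseteq> U" "indep S E"
    have "a = b" if "a \<in> S \<inter> ?N" "b \<in> S \<inter> ?N" for a b
      using that S(2) simp
      by (auto simp: indep_def simplicial_def clique_def nbhd_def insert_commute)
    moreover have finS: "finite S" by (rule finite_subset[OF subset_trans[OF S(1) U(1)] fin])
    ultimately have "card (S \<inter> ?N) \<le> 1"
      unfolding One_nat_def by (subst card_le_Suc0_iff_eq) blast+
    moreover have "indep (S - ?N) E" using S(2) by (simp add: indep_def)
    then have "card (S - ?N) < n" using R[rule_format, of "S - ?N"] S(1) by (simp add: Diff_mono)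
    moreover from finS have "card S = card (S - ?N) + card (S \<inter> ?N)"
      by (simp add: card_Int_Diff[of S ?N])
    ultimately show "card S < Suc n" by simp
  qed
  then show ?thesis
    using fin U by (auto simp: mem_bounded_indep_complex)
qed

section \<open>Induction over the graph and the bound\<close>

text \<open>The index \<open>Suc n\<close> avoids truncated subtraction. The induction leaves
  \<open>n\<close> arbitrary because passing to the link lowers it by one.\<close>

lemma d_collapsible_bounded_indep_complex:
  assumes "finite V" "\<forall>e\<in>E. card e = 2" "chordal V E"
  shows "d_collapsible n (bounded_indep_complex (Suc n) V E)"
  using assms
proof (induction V arbitrary: n rule: finite_psubset_induct)
  case (psubset V)
  show ?case
  proof (cases "n = 0 \<or> V = {}")
    case True
    \<comment> \<open>Only the empty face exists: for \<open>n = 0\<close> a single vertex is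
      already an independent set that is too large.\<close>
    have "U = {}" if U: "U \<in> bounded_indep_complex (Suc n) V E" for U
    proof (rule ccontr)
      assume "U \<noteq> {}"
      then obtain a where "a \<in> U" by blast
      moreover from this True U have "n = 0" by (auto simp: bounded_indep_complex_def)
      moreover have "indep {a} E" by (simp add: indep_def)
      ultimately show False
        using U[unfolded mem_bounded_indep_complex[OF psubset.hyps], THEN conjunct2, rule_format, of "{a}"]
        by simp
    qed
    moreover have "{} \<in> bounded_indep_complex (Suc n) V E"
      using psubset.hyps by (simp add: mem_bounded_indep_complex)
    ultimately have "bounded_indep_complex (Suc n) V E = {{}}" by blast
    \<comment> \<open>The empty face is free and has size 0, so removing it reaches the void complex
      for every \<open>n\<close>.\<close>
    moreover have "elementary_collapse n {{}} {}"
      by (auto simp: elementary_collapse_def free_face_in_def maximal_face_def)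
    ultimately show ?thesis by (auto simp: d_collapsible_def)
  next
    case False
    then obtain k where n: "n = Suc k" by (metis not0_implies_Suc)
    obtain v where v: "simplicial V E v"
      using chordal_ex_simplicial_vertex[OF psubset.hyps psubset.prems] False by blast
    then have vV: "v \<in> V" by (simp add: simplicial_def)
    let ?N = "nbhd V E v"
    let ?L = "bounded_indep_complex (Suc k) (V - insert v ?N) E"
    let ?Y = "bounded_indep_complex (Suc n) (V - {v}) E"
    \<comment> \<open>Used for the link with \<open>j = k\<close> and
      \<open>W = insert v ?N\<close>, and for the deletion of \<open>v\<close> with
      \<open>j = n\<close> and \<open>W = {v}\<close>.\<close>
    have IH: "d_collapsible j (bounded_indep_complex (Suc j) (V - W) E)" if "v \<in> W" for j W
      by (rule psubset.IH) (use that vV psubset.prems(1) chordal_subset[OF psubset.prems(2)] in auto)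
    have "bounded_indep_complex (Suc n) V E = ?Y \<union> {U. v \<in> U \<and> U - insert v ?N \<in> ?L}"
    proof (intro set_eqI)
      fix U
      show "U \<in> bounded_indep_complex (Suc n) V E
        \<longleftrightarrow> U \<in> ?Y \<union> {U. v \<in> U \<and> U - insert v ?N \<in> ?L}"
      proof (cases "v \<in> U")
        case True
        \<comment> \<open>\<open>?L\<close> controls \<open>U\<close> only outside the closed
          neighbourhood of \<open>v\<close>, which itself lies in \<open>V\<close>.\<close>
        have "U \<subseteq> V" if "U - insert v ?N \<in> ?L"
          using that vV by (auto simp: bounded_indep_complex_def nbhd_def)
        then show ?thesis
          using True bounded_indep_complex_simplicial[OF psubset.hyps v _ True, of n] n
          by (auto simp: bounded_indep_complex_def)
      next
        case False
        then show ?thesis by (auto simp: bounded_indep_complex_def)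
      qed
    qed
    moreover have "d_collapsible n (?Y \<union> {U. v \<in> U \<and> U - insert v ?N \<in> ?L})"
      unfolding n
      by (rule d_collapsible_star) (use IH in \<open>auto simp: bounded_indep_complex_def\<close>)
    ultimately show ?thesis by simp
  qed
qed

theorem theorem1p5:
  fixes V :: "'a set" and E :: "'a set set" and n :: nat
  assumes "simple_graph V E"
    and "chordal V E"
    and "n \<ge> 1"
  shows "collapsibility_number (bounded_indep_complex n V E) \<le> n - 1"
proof -
  have "finite V" "\<forall>e\<in>E. card e = 2"
    using assms(1) by (auto simp: simple_graph_def nsets_def)
  \<comment> \<open>By \<open>n \<ge> 1\<close>, the index \<open>Suc (n - 1)\<close> is
    \<open>n\<close>.\<close>
  then have "d_collapsible (n - 1) (bounded_indep_complex (Suc (n - 1)) V E)"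
    using assms(2) by (rule d_collapsible_bounded_indep_complex)
  then show ?thesis
    using assms(3) unfolding collapsibility_number_def by (simp add: Least_le)
qed

end
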